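(* Let $n,k\ge 1$, let $Q_1,\dots,Q_k\in\mathbb{R}^{n\times n}$ be symmetric positive definite matrices, and let $\mathcal{H}=\bigoplus_{i=1}^k\mathcal{E}(Q_i)$. Let $\ell\in\mathbb{R}^n$ be a unit vector and set $$Q_\ell=\left(\sum_{i=1}^k\langle\ell,Q_i\ell\rangle^{\frac12}\right)\left(\sum_{i=1}^k\langle\ell,Q_i\ell\rangle^{-\frac12}Q_i\right),\qquad x=\sum_{i=1}^k\langle\ell,Q_i\ell\rangle^{-\frac12}Q_i\ell .$$ Then the ellipsoids $\mathcal{E}(Q)$ with $Q=Q_0+Q_\ell$, where $Q_0\in\mathbb{R}^{n\times n}$ ranges over the symmetric matrices satisfying 1. $Q_0+Q_\ell$ is positive definite, 2. $\ell\in\ker(Q_0)$, 3. $\langle\tilde\ell,(Q_0+Q_\ell)\tilde\ell\rangle^{\frac12}\ge\sum_{i=1}^k\langle\tilde\ell,Q_i\tilde\ell\rangle^{\frac12}$ for all $\tilde\ell$ in the unit ball $\mathcal{B}_1(0)$ of $\mathbb{R}^n$, are exactly the ellipsoids $\mathcal{E}(Q)$ ($Q$ symmetric positive definite) that are outer bounds of the geometric sum, $\mathcal{H}\subseteq\mathcal{E}(Q)$, and that touch the boundary of $\mathcal{H}$ at the point $x$, i.e. $x\in\partial\mathcal{H}\cap\partial\mathcal{E}(Q)$. Moreover each of these ellipsoids is tangent to $\mathcal{H}$ at $x$.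
   Context: For a symmetric positive definite matrix $Q\in\mathbb{R}^{n\times n}$, the ellipsoid centered at zero with shape matrix $Q$ is $\mathcal{E}(Q)=\{\xi\in\mathbb{R}^n\mid \xi^TQ^{-1}\xi\le 1\}$. The geometric (Minkowski) sum of convex sets $\mathcal{S}_1,\mathcal{S}_2\subset\mathbb{R}^n$ is $\mathcal{S}_1\oplus\mathcal{S}_2=\{s_1+s_2\mid s_1\in\mathcal{S}_1,\ s_2\in\mathcal{S}_2\}$, and $\bigoplus_{i=1}^k$ denotes the iterated sum. $\langle\cdot,\cdot\rangle$ is the standard inner product on $\mathbb{R}^n$; $\partial$ denotes topological boundary. "$\mathcal{E}(Q)$ is tangent to $\mathcal{H}$ at $x$" means that $x\in\partial\mathcal{H}\cap\partial\mathcal{E}(Q)$ and that the hyperplane through $x$ with normal vector $\ell$ supports both convex sets at $x$, i.e. $\langle\ell,y\rangle\le\langle\ell,x\rangle$ for all $y\in\mathcal{H}$ and all $y\in\mathcal{E}(Q)$. *)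

theory Defs
  imports "HOL-Analysis.Analysis" "HOL-Library.Set_Algebras"
begin

definition symmetric_mat :: "real ^ 'n ^ 'n \<Rightarrow> bool" where
  "symmetric_mat Q \<longleftrightarrow> transpose Q = Q"

text \<open>Symmetry is not part of the following notion; it is always required separately.\<close>

definition pos_def :: "real ^ 'n ^ 'n \<Rightarrow> bool" where
  "pos_def Q \<longleftrightarrow> (\<forall>v. v \<noteq> 0 \<longrightarrow> 0 < v \<bullet> (Q *v v))"

text \<open>Only meaningful for symmetric positive definite \<open>Q\<close>; for singular \<open>Q\<close> the
  value of \<^const>\<open>matrix_inv\<close> is unspecified.\<close>

definition ellipsoid :: "real ^ 'n ^ 'n \<Rightarrow> (real ^ 'n) set" where
  "ellipsoid Q = {\<xi>. \<xi> \<bullet> (matrix_inv Q *v \<xi>) \<le> 1}"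

definition tangent_at :: "real ^ 'n \<Rightarrow> (real ^ 'n) set \<Rightarrow> (real ^ 'n) set \<Rightarrow> real ^ 'n \<Rightarrow> bool" where
  "tangent_at l E H x \<longleftrightarrow>
     x \<in> frontier H \<inter> frontier E \<and>
     (\<forall>y\<in>H. l \<bullet> y \<le> l \<bullet> x) \<and> (\<forall>y\<in>E. l \<bullet> y \<le> l \<bullet> x)"

text \<open>The geometric (Minkowski) sum of sets is the addition on sets from
  \<^theory>\<open>HOL-Library.Set_Algebras\<close>; the iterated sum is \<^const>\<open>sum\<close> over that addition.\<close>

end

theory Submission
  imports Defs
begin

text \<open>The reason is duality. For symmetric positive definite \<open>P\<close> the support function of
  \<open>ellipsoid P\<close> is \<open>v \<mapsto> sqrt (v \<bullet> P v)\<close>, attained at \<open>P v / sqrt (v \<bullet> P v)\<close>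
  (\<open>inner_le_of_mem_ellipsoid\<close>, \<open>support_point_of_ellipsoid\<close>), and it determines the ellipsoid
  (\<open>mem_ellipsoidI\<close>). Support functions add under Minkowski sums, so the third condition on
  \<open>Q0\<close> is just the inclusion of the sum in the ellipsoid, expressed by support functions
  (\<open>minkowski_sum_subset_ellipsoid_iff\<close>).

  Write \<open>s\<close> for the value at \<open>l\<close> of the support function of the sum; it is attained at \<open>x\<close>. The
  matrix \<open>Ql\<close> sends \<open>l\<close> to \<open>s x\<close>, so \<open>Q0 l = 0\<close> says that \<open>P = Q0 + Ql\<close> satisfies
  \<open>P l = s x\<close>, which makes \<open>x\<close> the point where \<open>ellipsoid P\<close> has outer normal \<open>l\<close>. Hence
  contact and tangency. Conversely, suppose that an outer ellipsoid touches the sum at \<open>x\<close>, with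
  outer normal \<open>w\<close> there. Then \<open>w\<close> is also normal to the sum at \<open>x\<close>, hence normal to every
  summand at the corresponding component of \<open>x\<close>. The boundary of an ellipsoid is smooth, so its
  normal at a point is unique up to scaling; in algebraic terms, this is the equality case of the
  Cauchy--Schwarz inequality for \<open>Q i\<close> (\<open>pos_def_Cauchy_Schwarz_eq_imp_parallel\<close>). Therefore
  \<open>w\<close> is a multiple of \<open>l\<close>, and \<open>P l = s x\<close> follows.\<close>

section \<open>Cauchy--Schwarz for positive definite matrices\<close>

lemma symmetric_inner_mult:
  fixes P :: "real ^ 'n ^ 'n"
  assumes "symmetric_mat P"
  shows "v \<bullet> (P *v w) = w \<bullet> (P *v v)"
  using assms unfolding symmetric_mat_def
  by (metis dot_lmul_matrix inner_commute transpose_matrix_vector)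

lemma pos_def_nonneg: "pos_def P \<Longrightarrow> 0 \<le> v \<bullet> (P *v v)"
  by (cases "v = 0") (auto simp: pos_def_def less_imp_le)

text \<open>The gap in the Cauchy--Schwarz inequality is, up to the factor \<open>v \<bullet> P v\<close>, the square
  length of the component of \<open>w\<close> orthogonal to \<open>v\<close> in the inner product given by \<open>P\<close>; the inequality and its equality case can both be read off.\<close>

lemma Cauchy_Schwarz_gap:
  fixes P :: "real ^ 'n ^ 'n" and v w :: "real ^ 'n"
  assumes "symmetric_mat P" "pos_def P" "v \<noteq> 0"
  defines "c \<equiv> (v \<bullet> (P *v w)) / (v \<bullet> (P *v v))"
  shows "(w - c *\<^sub>R v) \<bullet> (P *v (w - c *\<^sub>R v)) * (v \<bullet> (P *v v))
    = (w \<bullet> (P *v w)) * (v \<bullet> (P *v v)) - (v \<bullet> (P *v w))\<^sup>2"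
proof -
  have pos: "0 < v \<bullet> (P *v v)" using assms by (simp add: pos_def_def)
  have "(w - c *\<^sub>R v) \<bullet> (P *v (w - c *\<^sub>R v))
      = w \<bullet> (P *v w) - 2 * c * (v \<bullet> (P *v w)) + c\<^sup>2 * (v \<bullet> (P *v v))"
    using symmetric_inner_mult[OF assms(1), of w v]
    by (simp add: matrix_vector_mult_diff_distrib matrix_vector_mult_scaleR inner_diff_left
        inner_diff_right algebra_simps power2_eq_square)
  then show ?thesis
    using pos unfolding c_def by (simp add: field_simps power2_eq_square)
qed

lemma pos_def_Cauchy_Schwarz:
  fixes P :: "real ^ 'n ^ 'n"
  assumes "symmetric_mat P" "pos_def P"
  shows "v \<bullet> (P *v w) \<le> sqrt (v \<bullet> (P *v v)) * sqrt (w \<bullet> (P *v w))"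
proof (cases "v = 0")
  case False
  have "0 \<le> (w \<bullet> (P *v w)) * (v \<bullet> (P *v v)) - (v \<bullet> (P *v w))\<^sup>2"
    unfolding Cauchy_Schwarz_gap[OF assms False, symmetric]
    using assms by (intro mult_nonneg_nonneg pos_def_nonneg)
  then have "v \<bullet> (P *v w) \<le> sqrt ((v \<bullet> (P *v v)) * (w \<bullet> (P *v w)))"
    by (intro real_le_rsqrt) (simp add: mult.commute)
  then show ?thesis by (simp add: real_sqrt_mult)
qed simp

lemma pos_def_Cauchy_Schwarz_eq_imp_parallel:
  fixes P :: "real ^ 'n ^ 'n"
  assumes "symmetric_mat P" "pos_def P" "v \<noteq> 0"
    and "v \<bullet> (P *v w) = sqrt (v \<bullet> (P *v v)) * sqrt (w \<bullet> (P *v w))"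
  obtains c where "w = c *\<^sub>R v"
proof -
  define c where "c = (v \<bullet> (P *v w)) / (v \<bullet> (P *v v))"
  have "(v \<bullet> (P *v w))\<^sup>2 = (v \<bullet> (P *v v)) * (w \<bullet> (P *v w))"
    using assms(2,4) by (simp add: power_mult_distrib pos_def_nonneg)
  then have "(w - c *\<^sub>R v) \<bullet> (P *v (w - c *\<^sub>R v)) * (v \<bullet> (P *v v)) = 0"
    using Cauchy_Schwarz_gap[OF assms(1-3), of w] by (simp add: c_def)
  then have "w - c *\<^sub>R v = 0"
    using assms(2,3) unfolding pos_def_def by (metis less_irrefl mult_eq_0_iff)
  then have "w = c *\<^sub>R v" by simp
  then show thesis by (rule that)
qed

section \<open>Ellipsoids and their support functions\<close>

lemma pos_def_invertible:
  fixes P :: "real ^ 'n ^ 'n"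
  assumes "pos_def P"
  shows "invertible P"
proof -
  have "v = 0" if "P *v v = 0" for v
    using assms that unfolding pos_def_def by (metis inner_zero_right less_irrefl)
  then show ?thesis
    using matrix_left_invertible_ker[of P] by (simp add: invertible_left_inverse)
qed

lemma matrix_inv_cancel:
  fixes A :: "real ^ 'n ^ 'n"
  assumes "invertible A"
  shows "A ** matrix_inv A = mat 1" "matrix_inv A ** A = mat 1"
  using someI_ex[OF assms[unfolded invertible_def]] unfolding matrix_inv_def by auto

lemma matrix_inv_mult_vec:
  fixes P :: "real ^ 'n ^ 'n"
  assumes "pos_def P"
  shows "matrix_inv P *v (P *v w) = w"
  using matrix_inv_cancel(2)[OF pos_def_invertible[OF assms]]
  by (simp add: matrix_vector_mul_assoc)

text \<open>Points are from now on written as \<open>P *v w\<close>; this removes the inverse matrix, and \<open>w\<close> is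
  an outer normal of the level set through the point.\<close>

lemma pos_def_preimage:
  fixes P :: "real ^ 'n ^ 'n"
  assumes "pos_def P"
  obtains w where "y = P *v w"
  using matrix_inv_cancel(1)[OF pos_def_invertible[OF assms]] that[of "matrix_inv P *v y"]
  by (simp add: matrix_vector_mul_assoc)

lemma mult_mem_ellipsoid_iff:
  fixes P :: "real ^ 'n ^ 'n"
  assumes "pos_def P"
  shows "P *v w \<in> ellipsoid P \<longleftrightarrow> w \<bullet> (P *v w) \<le> 1"
  using assms by (simp add: ellipsoid_def matrix_inv_mult_vec inner_commute)

lemma inner_le_of_mem_ellipsoid:
  fixes P :: "real ^ 'n ^ 'n"
  assumes "symmetric_mat P" "pos_def P" "y \<in> ellipsoid P"
  shows "v \<bullet> y \<le> sqrt (v \<bullet> (P *v v))"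
proof -
  obtain w where w: "y = P *v w" using pos_def_preimage assms(2) by blast
  have "sqrt (w \<bullet> (P *v w)) \<le> 1"
    using assms w by (simp add: mult_mem_ellipsoid_iff)
  then have "sqrt (v \<bullet> (P *v v)) * sqrt (w \<bullet> (P *v w)) \<le> sqrt (v \<bullet> (P *v v)) * 1"
    using assms(2) by (intro mult_left_mono) (simp_all add: pos_def_nonneg)
  with pos_def_Cauchy_Schwarz[OF assms(1,2), of v w] w show ?thesis by simp
qed

lemma support_point_of_ellipsoid:
  fixes P :: "real ^ 'n ^ 'n"
  assumes "pos_def P" "v \<noteq> 0"
  shows "inverse (sqrt (v \<bullet> (P *v v))) *\<^sub>R (P *v v) \<in> ellipsoid P"
    and "v \<bullet> (inverse (sqrt (v \<bullet> (P *v v))) *\<^sub>R (P *v v)) = sqrt (v \<bullet> (P *v v))"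
proof -
  have pos: "0 < v \<bullet> (P *v v)" using assms by (simp add: pos_def_def)
  show "inverse (sqrt (v \<bullet> (P *v v))) *\<^sub>R (P *v v) \<in> ellipsoid P"
    using mult_mem_ellipsoid_iff[OF assms(1), of "inverse (sqrt (v \<bullet> (P *v v))) *\<^sub>R v"] pos
    by (simp add: matrix_vector_mult_scaleR field_simps)
  show "v \<bullet> (inverse (sqrt (v \<bullet> (P *v v))) *\<^sub>R (P *v v)) = sqrt (v \<bullet> (P *v v))"
    using pos by (simp add: field_simps)
qed

text \<open>The single direction \<open>v\<close> with \<open>y = P *v v\<close> already tests membership of \<open>y\<close>: for
  \<open>q = v \<bullet> y\<close> the hypothesis reads \<open>q \<le> sqrt q\<close>, which forces \<open>q \<le> 1\<close>.\<close>

lemma mem_ellipsoidI: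
  fixes P :: "real ^ 'n ^ 'n"
  assumes "pos_def P" "\<And>v. v \<bullet> y \<le> sqrt (v \<bullet> (P *v v))"
  shows "y \<in> ellipsoid P"
proof -
  obtain w where w: "y = P *v w" using pos_def_preimage assms(1) by blast
  have nonneg: "0 \<le> w \<bullet> (P *v w)" using assms(1) by (rule pos_def_nonneg)
  have "w \<bullet> (P *v w) \<le> sqrt (w \<bullet> (P *v w))" using assms(2)[of w] w by simp
  then have "(w \<bullet> (P *v w))\<^sup>2 \<le> w \<bullet> (P *v w)"
    using nonneg by (metis power_mono real_sqrt_pow2)
  then have "w \<bullet> (P *v w) \<le> 1"
    using nonneg by (cases "w \<bullet> (P *v w) = 0") (auto simp: power2_eq_square)
  then show ?thesis using w assms(1) by (simp add: mult_mem_ellipsoid_iff)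
qed

lemma mult_mem_frontier_ellipsoid:
  fixes P :: "real ^ 'n ^ 'n"
  assumes "pos_def P" "P *v w \<in> frontier (ellipsoid P)"
  shows "w \<bullet> (P *v w) = 1"
proof -
  let ?q = "\<lambda>y. y \<bullet> (matrix_inv P *v y)"
  have cont: "continuous_on UNIV ?q"
    by (intro continuous_intros matrix_vector_mult_linear_continuous_on)
  have "closed (ellipsoid P)"
    unfolding ellipsoid_def using cont by (intro closed_Collect_le continuous_intros)
  then have "?q (P *v w) \<le> 1"
    using assms(2) frontier_subset_closed unfolding ellipsoid_def by blast
  moreover have "{y. ?q y < 1} \<subseteq> interior (ellipsoid P)"
    using cont by (intro interior_maximal open_Collect_less continuous_intros)
      (auto simp: ellipsoid_def)
  then have "\<not> ?q (P *v w) < 1"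
    using assms(2) unfolding frontier_def by blast
  ultimately show ?thesis
    using assms(1) by (simp add: matrix_inv_mult_vec inner_commute)
qed

lemma frontier_of_support_point:
  fixes x v :: "'a :: euclidean_space"
  assumes "x \<in> S" "v \<noteq> 0" "\<And>y. y \<in> S \<Longrightarrow> v \<bullet> y \<le> v \<bullet> x"
  shows "x \<in> frontier S"
proof -
  have "x \<notin> interior S"
  proof
    assume "x \<in> interior S"
    moreover have "interior S \<subseteq> interior {y. v \<bullet> y \<le> v \<bullet> x}"
      using assms(3) by (intro interior_mono) auto
    ultimately show False
      using interior_halfspace_le[OF assms(2)] by auto
  qed
  then show ?thesis
    using assms(1) closure_subset unfolding frontier_def by auto
qed

section \<open>Minkowski sums of ellipsoids\<close>

lemma inner_le_of_mem_minkowski_sum: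
  fixes Q :: "'i \<Rightarrow> real ^ 'n ^ 'n"
  assumes "finite I" "\<And>i. i \<in> I \<Longrightarrow> symmetric_mat (Q i) \<and> pos_def (Q i)"
    and "y \<in> (\<Sum>i\<in>I. ellipsoid (Q i))"
  shows "v \<bullet> y \<le> (\<Sum>i\<in>I. sqrt (v \<bullet> (Q i *v v)))"
proof -
  obtain s where "y = sum s I" "\<And>i. i \<in> I \<Longrightarrow> s i \<in> ellipsoid (Q i)"
    using assms(1,3) by (auto simp: set_sum_alt)
  then show ?thesis
    using assms(2) by (auto simp: inner_sum_right intro!: sum_mono inner_le_of_mem_ellipsoid)
qed

lemma support_point_of_minkowski_sum:
  fixes Q :: "'i \<Rightarrow> real ^ 'n ^ 'n"
  assumes "finite I" "\<And>i. i \<in> I \<Longrightarrow> pos_def (Q i)" "v \<noteq> 0"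
  defines "y \<equiv> \<Sum>i\<in>I. inverse (sqrt (v \<bullet> (Q i *v v))) *\<^sub>R (Q i *v v)"
  shows "y \<in> (\<Sum>i\<in>I. ellipsoid (Q i))"
    and "v \<bullet> y = (\<Sum>i\<in>I. sqrt (v \<bullet> (Q i *v v)))"
proof -
  show "y \<in> (\<Sum>i\<in>I. ellipsoid (Q i))"
    unfolding y_def set_sum_alt[OF assms(1)]
    using support_point_of_ellipsoid(1)[OF assms(2) assms(3)]
    by (intro CollectI exI[of _ "\<lambda>i. inverse (sqrt (v \<bullet> (Q i *v v))) *\<^sub>R (Q i *v v)"]) simp
  show "v \<bullet> y = (\<Sum>i\<in>I. sqrt (v \<bullet> (Q i *v v)))"
    using assms(2,3) unfolding y_def inner_sum_right
    by (intro sum.cong support_point_of_ellipsoid(2)) auto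
qed

text \<open>Both sides of the support function inequality are positively homogeneous, so the unit ball
  contains enough directions.\<close>

lemma minkowski_sum_subset_ellipsoid_iff:
  fixes Q :: "'i \<Rightarrow> real ^ 'n ^ 'n" and P :: "real ^ 'n ^ 'n"
  assumes "finite I" "\<And>i. i \<in> I \<Longrightarrow> symmetric_mat (Q i) \<and> pos_def (Q i)"
    and P: "symmetric_mat P" "pos_def P"
  shows "(\<Sum>i\<in>I. ellipsoid (Q i)) \<subseteq> ellipsoid P \<longleftrightarrow>
    (\<forall>v \<in> cball 0 1. sqrt (v \<bullet> (P *v v)) \<ge> (\<Sum>i\<in>I. sqrt (v \<bullet> (Q i *v v))))"
    (is "?L \<longleftrightarrow> ?R")
proof
  assume L: ?L
  show ?R
  proof
    fix v :: "real ^ 'n"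
    show "sqrt (v \<bullet> (P *v v)) \<ge> (\<Sum>i\<in>I. sqrt (v \<bullet> (Q i *v v)))"
    proof (cases "v = 0")
      case False
      then obtain y where "y \<in> ellipsoid P" "v \<bullet> y = (\<Sum>i\<in>I. sqrt (v \<bullet> (Q i *v v)))"
        using support_point_of_minkowski_sum[of I Q v] assms(1,2) L by blast
      then show ?thesis using inner_le_of_mem_ellipsoid[OF P, of y v] by simp
    qed simp
  qed
next
  assume R: ?R
  have scale: "sqrt ((c *\<^sub>R v) \<bullet> (A *v (c *\<^sub>R v))) = c * sqrt (v \<bullet> (A *v v))"
    if "c \<ge> 0" for c v and A :: "real ^ 'n ^ 'n"
    using that by (simp add: matrix_vector_mult_scaleR real_sqrt_mult mult.assoc[symmetric])
  have all: "(\<Sum>i\<in>I. sqrt (v \<bullet> (Q i *v v))) \<le> sqrt (v \<bullet> (P *v v))" for v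
  proof (cases "v = 0")
    case False
    define u where "u = inverse (norm v) *\<^sub>R v"
    have v: "v = norm v *\<^sub>R u" and "u \<in> cball 0 1"
      using False by (simp_all add: u_def)
    with R have "norm v * (\<Sum>i\<in>I. sqrt (u \<bullet> (Q i *v u))) \<le> norm v * sqrt (u \<bullet> (P *v u))"
      by (intro mult_left_mono) auto
    moreover have "sqrt (v \<bullet> (A *v v)) = norm v * sqrt (u \<bullet> (A *v u))" for A
      using scale[of "norm v" u A] v by simp
    ultimately show ?thesis by (simp add: sum_distrib_left)
  qed simp
  show ?L
    using inner_le_of_mem_minkowski_sum[OF assms(1,2)] all P
    by (meson mem_ellipsoidI order_trans subsetI)
qed

text \<open>The converse half of the characterization: at a common boundary point with an enclosing
  ellipsoid, the outer normal \<open>l\<close> of the sum is forced upon the ellipsoid. The ellipsoid has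
  some outer normal \<open>w\<close> at \<open>x\<close>, which is then normal to every summand as well; since an
  ellipsoid has only one normal direction at a boundary point, any one of the summands shows that
  \<open>w\<close> is parallel to \<open>l\<close>.\<close>

lemma normal_of_touching_ellipsoid:
  fixes Q :: "'i \<Rightarrow> real ^ 'n ^ 'n" and P :: "real ^ 'n ^ 'n"
  assumes I: "finite I" and Q: "\<And>i. i \<in> I \<Longrightarrow> symmetric_mat (Q i) \<and> pos_def (Q i)"
    and P: "symmetric_mat P" "pos_def P" and l: "l \<noteq> 0"
    and sub: "(\<Sum>i\<in>I. ellipsoid (Q i)) \<subseteq> ellipsoid P"
  defines "x \<equiv> \<Sum>i\<in>I. inverse (sqrt (l \<bullet> (Q i *v l))) *\<^sub>R (Q i *v l)"
  assumes x: "x \<in> frontier (ellipsoid P)"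
  shows "P *v l = (\<Sum>i\<in>I. sqrt (l \<bullet> (Q i *v l))) *\<^sub>R x"
proof -
  define z where "z = (\<lambda>i. inverse (sqrt (l \<bullet> (Q i *v l))) *\<^sub>R (Q i *v l))"
  obtain w where w: "x = P *v w" using pos_def_preimage P(2) by blast
  have wx: "w \<bullet> x = 1" using mult_mem_frontier_ellipsoid P(2) x w by simp
  then have w0: "w \<noteq> 0" by auto
  have "(\<Sum>i\<in>I. sqrt (w \<bullet> (Q i *v w))) \<le> sqrt (w \<bullet> (P *v w))"
  proof -
    obtain y where "y \<in> ellipsoid P" "w \<bullet> y = (\<Sum>i\<in>I. sqrt (w \<bullet> (Q i *v w)))"
      using support_point_of_minkowski_sum[of I Q w] I Q w0 sub by blast
    then show ?thesis using inner_le_of_mem_ellipsoid[OF P, of y w] by simp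
  qed
  also have "\<dots> = (\<Sum>i\<in>I. w \<bullet> z i)"
    using wx unfolding w[symmetric] by (simp add: x_def z_def inner_sum_right)
  finally have total: "(\<Sum>i\<in>I. sqrt (w \<bullet> (Q i *v w))) \<le> (\<Sum>i\<in>I. w \<bullet> z i)" .
  have each: "w \<bullet> z i \<le> sqrt (w \<bullet> (Q i *v w))" if "i \<in> I" for i
    using that Q l unfolding z_def
    by (intro inner_le_of_mem_ellipsoid support_point_of_ellipsoid(1)) auto
  \<comment> \<open>the termwise bounds add up to an equality, so each of them is one\<close>
  have "I \<noteq> {}" using wx by (auto simp: x_def)
  then obtain i where i: "i \<in> I" by blast
  have "w \<bullet> z i = sqrt (w \<bullet> (Q i *v w))"
  proof (rule ccontr)
    assume "w \<bullet> z i \<noteq> sqrt (w \<bullet> (Q i *v w))"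
    then have "(\<Sum>i\<in>I. w \<bullet> z i) < (\<Sum>i\<in>I. sqrt (w \<bullet> (Q i *v w)))"
      using each i I by (intro sum_strict_mono_ex1) force+
    with total show False by simp
  qed
  moreover have "0 < l \<bullet> (Q i *v l)" using Q i l by (simp add: pos_def_def)
  ultimately have "l \<bullet> (Q i *v w) = sqrt (l \<bullet> (Q i *v l)) * sqrt (w \<bullet> (Q i *v w))"
    using symmetric_inner_mult[of "Q i" l w] Q i by (simp add: z_def field_simps)
  then obtain c where c: "w = c *\<^sub>R l"
    using pos_def_Cauchy_Schwarz_eq_imp_parallel Q i l by metis
  define s where "s = (\<Sum>i\<in>I. sqrt (l \<bullet> (Q i *v l)))"
  have "l \<bullet> x = s"
    using support_point_of_minkowski_sum(2)[of I Q l] I Q l by (simp add: x_def s_def)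
  then have "s * c = 1" using wx c by (simp add: mult.commute)
  then have "P *v l = s *\<^sub>R (P *v w)"
    by (simp add: c matrix_vector_mult_scaleR)
  then show ?thesis using w by (simp add: s_def)
qed

lemma sum_matrix_vector_mult:
  fixes A :: "'i \<Rightarrow> real ^ 'n ^ 'm"
  shows "(\<Sum>i\<in>I. A i) *v v = (\<Sum>i\<in>I. A i *v v)"
  by (induction I rule: infinite_finite_induct) (simp_all add: matrix_vector_mult_add_rdistrib)

lemma symmetric_mat_add: "symmetric_mat A \<Longrightarrow> symmetric_mat B \<Longrightarrow> symmetric_mat (A + B)"
  and symmetric_mat_diff: "symmetric_mat A \<Longrightarrow> symmetric_mat B \<Longrightarrow> symmetric_mat (A - B)"
  and symmetric_mat_scaleR: "symmetric_mat A \<Longrightarrow> symmetric_mat (c *\<^sub>R A)"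
  by (simp_all add: symmetric_mat_def transpose_def vec_eq_iff)

lemma symmetric_mat_sum:
  "(\<And>i. i \<in> I \<Longrightarrow> symmetric_mat (A i)) \<Longrightarrow> symmetric_mat (\<Sum>i\<in>I. A i)"
  by (induction I rule: infinite_finite_induct)
    (simp_all add: symmetric_mat_add, simp_all add: symmetric_mat_def transpose_def vec_eq_iff)

section \<open>The outer ellipsoids touching at a given point\<close>

theorem corollary3:
  fixes Q :: "nat \<Rightarrow> real ^ 'n ^ 'n" and k :: nat and l x :: "real ^ 'n"
    and H :: "(real ^ 'n) set" and Ql :: "real ^ 'n ^ 'n" and \<E> :: "(real ^ 'n) set set"
  assumes "k \<ge> 1"
    and "\<And>i. i \<in> {1..k} \<Longrightarrow> symmetric_mat (Q i) \<and> pos_def (Q i)"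
    and "norm l = 1"
    and "H = (\<Sum>i=1..k. ellipsoid (Q i))"
    and "Ql = (\<Sum>i=1..k. sqrt (l \<bullet> (Q i *v l))) *\<^sub>R
              (\<Sum>i=1..k. inverse (sqrt (l \<bullet> (Q i *v l))) *\<^sub>R Q i)"
    and "x = (\<Sum>i=1..k. inverse (sqrt (l \<bullet> (Q i *v l))) *\<^sub>R (Q i *v l))"
    and "\<E> = {ellipsoid (Q0 + Ql) | Q0.
               symmetric_mat Q0 \<and>
               pos_def (Q0 + Ql) \<and>
               Q0 *v l = 0 \<and>
               (\<forall>l' \<in> cball 0 1. sqrt (l' \<bullet> ((Q0 + Ql) *v l')) \<ge> (\<Sum>i=1..k. sqrt (l' \<bullet> (Q i *v l'))))}"
  shows "\<E> = {ellipsoid P | P.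
               symmetric_mat P \<and> pos_def P \<and>
               H \<subseteq> ellipsoid P \<and> x \<in> frontier H \<inter> frontier (ellipsoid P)}
         \<and> (\<forall>E \<in> \<E>. tangent_at l E H x)"
proof -
  define s where "s = (\<Sum>i=1..k. sqrt (l \<bullet> (Q i *v l)))"
  have l: "l \<noteq> 0" using assms(3) by auto
  have Qpd: "pos_def (Q i)" if "i \<in> {1..k}" for i using assms(2) that by blast
  have xH: "x \<in> H" and lx: "l \<bullet> x = s"
    using support_point_of_minkowski_sum[of "{1..k}" Q l] Qpd l
    by (simp_all add: assms(4,6) s_def)
  have H_le: "l \<bullet> y \<le> l \<bullet> x" if "y \<in> H" for y
    using inner_le_of_mem_minkowski_sum[of "{1..k}" Q y l] assms(2,4) that lx
    by (simp add: s_def)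
  have x_front: "x \<in> frontier H"
    using frontier_of_support_point[OF xH l H_le] .
  have Ql_sym: "symmetric_mat Ql"
    using assms(2) unfolding assms(5)
    by (intro symmetric_mat_scaleR symmetric_mat_sum) blast
  have Ql_l: "Ql *v l = s *\<^sub>R x"
    unfolding assms(5,6) s_def
    by (simp add: scaleR_matrix_vector_assoc[symmetric] sum_matrix_vector_mult)
  have "s > 0"
    unfolding s_def using assms(1) Qpd l by (intro sum_pos) (auto simp: pos_def_def)
  have sub_iff: "H \<subseteq> ellipsoid P \<longleftrightarrow>
      (\<forall>v \<in> cball 0 1. sqrt (v \<bullet> (P *v v)) \<ge> (\<Sum>i=1..k. sqrt (v \<bullet> (Q i *v v))))"
    if "symmetric_mat P" "pos_def P" for P
    unfolding assms(4) using that assms(2) by (intro minkowski_sum_subset_ellipsoid_iff) auto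

  have tangent: "tangent_at l (ellipsoid P) H x"
    if P: "symmetric_mat P" "pos_def P" and Pl: "P *v l = s *\<^sub>R x" for P
  proof -
    have h: "sqrt (l \<bullet> (P *v l)) = s"
      using Pl lx \<open>s > 0\<close> by simp
    have xE: "x \<in> ellipsoid P"
      using support_point_of_ellipsoid(1)[OF P(2) l] Pl \<open>s > 0\<close> unfolding h by simp
    have E_le: "l \<bullet> y \<le> l \<bullet> x" if "y \<in> ellipsoid P" for y
      using inner_le_of_mem_ellipsoid[OF P that, of l] h lx by simp
    show ?thesis
      unfolding tangent_at_def
      using x_front frontier_of_support_point[OF xE l E_le] H_le E_le by blast
  qed

  have fwd: "symmetric_mat (Q0 + Ql) \<and> H \<subseteq> ellipsoid (Q0 + Ql)
      \<and> tangent_at l (ellipsoid (Q0 + Ql)) H x"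
    if "symmetric_mat Q0" "pos_def (Q0 + Ql)" "Q0 *v l = 0"
      "\<forall>l' \<in> cball 0 1. sqrt (l' \<bullet> ((Q0 + Ql) *v l')) \<ge> (\<Sum>i=1..k. sqrt (l' \<bullet> (Q i *v l')))" for Q0
  proof -
    have sym: "symmetric_mat (Q0 + Ql)" using that(1) Ql_sym by (rule symmetric_mat_add)
    moreover have "(Q0 + Ql) *v l = s *\<^sub>R x"
      by (simp add: matrix_vector_mult_add_rdistrib that(3) Ql_l)
    ultimately show ?thesis using sub_iff tangent that(2,4) by blast
  qed

  have bwd: "ellipsoid P \<in> \<E>"
    if P: "symmetric_mat P" "pos_def P" and sub: "H \<subseteq> ellipsoid P"
      and x: "x \<in> frontier (ellipsoid P)" for P
  proof -
    have "P *v l = s *\<^sub>R x"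
      using normal_of_touching_ellipsoid[of "{1..k}" Q P l] assms(2) P l sub x
      by (simp add: assms(4,6) s_def)
    then have "(P - Ql) *v l = 0"
      by (simp add: matrix_vector_mult_diff_rdistrib Ql_l)
    moreover have "symmetric_mat (P - Ql)" using P(1) Ql_sym by (rule symmetric_mat_diff)
    ultimately show ?thesis
      using P sub_iff[OF P] sub unfolding assms(7) by (intro CollectI exI[of _ "P - Ql"]) simp
  qed

  have tan_all: "tangent_at l E H x" if "E \<in> \<E>" for E
    using that fwd unfolding assms(7) by blast
  have "\<E> \<subseteq> {ellipsoid P | P. symmetric_mat P \<and> pos_def P \<and>
      H \<subseteq> ellipsoid P \<and> x \<in> frontier H \<inter> frontier (ellipsoid P)}"
    using fwd unfolding assms(7) tangent_at_def by blast
  with bwd tan_all show ?thesis by blast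
qed

end
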